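(* Consider the problem with observable costs, and let $(\hat S_t)_{t\in\mathbb{N}}$, $\hat S_t=\hat\sigma_t(M_t)\in\hat{\mathcal{S}}$, be an approximate information state with parameter $\epsilon\in\mathbb{R}_{\ge0}$. Let $$[\hat{\mathcal{T}}\hat\Lambda](\hat s)=\inf_{u\in\mathcal{U}}\ \sup_{(c,\hat s')\in[[C,\hat S'|\hat s,u]]}\big(c+\gamma\,\hat\Lambda(\hat s')\big),\qquad\hat s\in\hat{\mathcal{S}},$$ let $\hat\Lambda^0\equiv0$, $\hat\Lambda^n=\hat{\mathcal{T}}^n\hat\Lambda^0$, and let $\hat\Lambda^\infty=\lim_{n\to\infty}\hat\Lambda^n$ be the unique uniformly bounded fixed point of $\hat{\mathcal{T}}$. Suppose there is $L_{\hat\Lambda}\in\mathbb{R}_{\ge0}$ such that $\hat\Lambda^n$ is Lipschitz continuous with constant $L_{\hat\Lambda}$ for all $n\in\mathbb{N}$, and put $\hat L=\max\{\gamma L_{\hat\Lambda},1\}$. Then for every feasible initial observation $y_0$: (a) $\displaystyle |V_0(y_0)-\hat\Lambda^\infty(\hat\sigma_0(y_0))|\le\frac{\hat L\,\epsilon}{1-\gamma}$; (b) if the infimum over $u$ in $[\hat{\mathcal{T}}\hat\Lambda](\hat s)$ is achieved for all $\hat s\in\hat{\mathcal{S}}$ when $\hat\Lambda=\hat\Lambda^n$, $n\in\mathbb{N}$, and when $\hat\Lambda=\hat\Lambda^\infty$, if $\hat\pi^*:\hat{\mathcal{S}}\to\mathcal{U}$ is such that $\hat\pi^*(\hat s)$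 is a minimizer over $u\in\mathcal{U}$ of $\sup_{(c,\hat s')\in[[C,\hat S'|\hat s,u]]}(c+\gamma\hat\Lambda^\infty(\hat s'))$, and if $\hat{\boldsymbol g}^*=(\hat g^*_0,\hat g^*_1,\dots)$ with $\hat g_t^*(m_t)=\hat\pi^*(\hat\sigma_t(m_t))$, then $$|V_0(y_0)-V_0^{\hat{\boldsymbol g}^*}(y_0)|\le\frac{2\hat L\,\epsilon}{1-\gamma}.$$
   Context: Setting. $\mathbb{N}=\{0,1,2,\dots\}$, $\gamma\in(0,1)$. The nonempty sets $\mathcal{U},\mathcal{W},\mathcal{Y}$ are bounded subsets of a metric space $(E,\eta)$, and $\mathcal{C}\subset\mathbb{R}_{\ge0}$ is bounded with minimum $c^{\min}$ and maximum $c^{\max}$. An uncertain variable is a map $X:\Omega\to\mathcal{X}$ on a fixed sample space $\Omega$; its range is $[[X]]=\{X(\omega):\omega\in\Omega\}$, joint ranges are ranges of tuples, and the conditional range is $[[X|y]]=\{X(\omega): Y(\omega)=y,\ \omega\in\Omega\}$. Disturbances $W_t\in\mathcal{W}$, $t\in\mathbb{N}$, are independent uncertain variables (joint ranges are products of the individual ranges). The system is given by functions $h_0,h_{t+1},d_t$: with actions $U_t\in\mathcal{U}$, the observations are $Y_0=h_0(W_0)$, $Y_{t+1}=h_{t+1}(W_{0:t},U_{0:t})\in\mathcal{Y}$ and the costs are $C_t=d_t(W_{0:t},U_{0:t})\in\mathcal{C}$. Observable costs: the agent observes incurred costs, so the memory is $M_t=(Y_{0:t},C_{0:t-1},U_{0:t-1})$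 (with $M_0=Y_0$), with values in $\mathcal{M}_t$ (the product of the corresponding copies of $\mathcal{Y},\mathcal{C},\mathcal{U}$). A strategy is $\boldsymbol g=(g_0,g_1,\dots)$ with arbitrary $g_t:\mathcal{M}_t\to\mathcal{U}$ and $U_t=g_t(M_t)$; $\mathcal{G}$ is the set of strategies. A memory realization $m_t=(y_{0:t},c_{0:t-1},u_{0:t-1})$ is feasible if some disturbance realization produces observations $y_{0:t}$ and costs $c_{0:t-1}$ under actions $u_{0:t-1}$. Ranges conditioned on $m_t$ (or on $(m_t,u_t)$) are taken over all $\omega\in\Omega$ whose disturbances produce $y_{0:t},c_{0:t-1}$ under $u_{0:t-1}$, the past actions being $u_{0:t-1}$ (and the action at $t$ being $u_t$). A superscript $\boldsymbol g$ means that in addition all actions from time $t$ on are generated by $\boldsymbol g$. The accrued cost is $A_t=\sum_{\ell=0}^{t-1}\gamma^\ell C_\ell$ ($A_0=0$); the cost-to-go is $C_t^\infty=\sum_{\ell=t}^\infty\gamma^{\ell-t}C_\ell$. Value functions: $V_t^{\boldsymbol g}(m_t)=\sup_{(a_t,c_t^\infty)\in[[A_t,C_t^\infty|m_t]]^{\boldsymbol g}}(a_t+\gamma^tc_t^\infty)$ and $V_t(m_t)=\inf_{\boldsymbol g\in\mathcal{G}}V_t^{\boldsymbol g}(m_t)$. Hausdorff distance of bounded nonempty subsets $P,Q$ of a metric space with metric $\eta$: $\mathcal{H}(P,Q)=\max\{\sup_{p\in P}\inf_{q\in Q}\eta(p,q),\ \sup_{q\in Q}\inf_{p\in P}\eta(p,q)\}$.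 Products such as $\mathcal{C}\times\hat{\mathcal{S}}$ carry the sum of the component metrics, with $|c-c'|$ on $\mathcal{C}$. Approximate information state with parameter $\epsilon$: uncertain variables $\hat S_t=\hat\sigma_t(M_t)$, $t\in\mathbb{N}$, with values in a bounded, time-invariant subset $\hat{\mathcal{S}}$ of a metric space, such that for all $t\in\mathbb{N}$, all feasible $m_t$ and all $u_t\in\mathcal{U}$, $$\mathcal{H}\big([[C_t,\hat S_{t+1}|m_t,u_t]],\,[[C_t,\hat S_{t+1}|\hat\sigma_t(m_t),u_t]]\big)\le\epsilon,$$ where $[[C_t,\hat S_{t+1}|\hat s,u]]$ is the union of $[[C_t,\hat S_{t+1}|m_t,u]]$ over all feasible $m_t$ with $\hat\sigma_t(m_t)=\hat s$. These latter conditional ranges are time-invariant: there is a map $(\hat s,u)\mapsto[[C,\hat S'|\hat s,u]]$ from $\hat{\mathcal{S}}\times\mathcal{U}$ to nonempty subsets of $\mathcal{C}\times\hat{\mathcal{S}}$ with $[[C_t,\hat S_{t+1}|\hat s,u]]=[[C,\hat S'|\hat s,u]]$ for every $t$, every $u$ and every $\hat s$ that is the value $\hat\sigma_t(m_t)$ of some feasible $m_t$. The operator $\hat{\mathcal{T}}$ acts on uniformly bounded functions $\hat\Lambda:\hat{\mathcal{S}}\to\mathbb{R}$ and is a sup-norm contraction, so $\hat\Lambda^\infty$ exists and is unique. *)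

theory Defs
  imports "HOL-Analysis.Analysis"
begin

text \<open>The metric is an explicit argument because the library metric on pairs is the Euclidean
  combination of the component metrics, whereas products here carry the sum metric. Real-valued
  suprema and infima are meaningful for nonempty bounded sets, the only ones it is used for.\<close>

definition hausdorff_distance :: "('a \<Rightarrow> 'a \<Rightarrow> real) \<Rightarrow> 'a set \<Rightarrow> 'a set \<Rightarrow> real" where
  "hausdorff_distance \<eta> P Q = max (SUP p\<in>P. INF q\<in>Q. \<eta> p q) (SUP q\<in>Q. INF p\<in>P. \<eta> p q)"

definition sum_dist :: "'a::metric_space \<times> 'b::metric_space \<Rightarrow> 'a \<times> 'b \<Rightarrow> real" where
  "sum_dist x y = dist (fst x) (fst y) + dist (snd x) (snd y)"

text \<open>Independence of uncertain variables: every finite joint range is the product of the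
  individual ranges. Tuples indexed by \<open>I\<close> are extensional functions on \<open>I\<close>.\<close>

definition independent_uv :: "'o set \<Rightarrow> (nat \<Rightarrow> 'o \<Rightarrow> 'e) \<Rightarrow> bool" where
  "independent_uv \<Omega> X \<longleftrightarrow>
     (\<forall>I. finite I \<longrightarrow> (\<lambda>\<omega>. restrict (\<lambda>t. X t \<omega>) I) ` \<Omega> = (\<Pi>\<^sub>E t\<in>I. X t ` \<Omega>))"

text \<open>\<open>obs_next S t\<close> is the function \<open>h\<^bsub>t+1\<^esub>\<close> and \<open>cost_fun S t\<close> is \<open>d\<^sub>t\<close>; both take the
  list of disturbances and the list of actions at the times \<open>0, \<dots>, t\<close>.\<close>

record ('o, 'e) control_system =
  sample_space :: "'o set"
  act_set :: "'e set"
  dist_set :: "'e set"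
  obs_set :: "'e set"
  cost_set :: "real set"
  disturbance :: "nat \<Rightarrow> 'o \<Rightarrow> 'e"
  obs_init :: "'e \<Rightarrow> 'e"
  obs_next :: "nat \<Rightarrow> 'e list \<Rightarrow> 'e list \<Rightarrow> 'e"
  cost_fun :: "nat \<Rightarrow> 'e list \<Rightarrow> 'e list \<Rightarrow> real"

definition control_problem :: "('o, 'e::metric_space) control_system \<Rightarrow> bool" where
  "control_problem S \<longleftrightarrow>
     act_set S \<noteq> {} \<and> bounded (act_set S) \<and>
     dist_set S \<noteq> {} \<and> bounded (dist_set S) \<and>
     obs_set S \<noteq> {} \<and> bounded (obs_set S) \<and>
     cost_set S \<subseteq> {0..} \<and> bounded (cost_set S) \<and>
     (\<exists>cmin\<in>cost_set S. \<forall>c\<in>cost_set S. cmin \<le> c) \<and>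
     (\<exists>cmax\<in>cost_set S. \<forall>c\<in>cost_set S. c \<le> cmax) \<and>
     (\<forall>t. disturbance S t \<in> sample_space S \<rightarrow> dist_set S) \<and>
     independent_uv (sample_space S) (disturbance S) \<and>
     obs_init S \<in> dist_set S \<rightarrow> obs_set S \<and>
     (\<forall>t ws us. length ws = Suc t \<and> set ws \<subseteq> dist_set S \<and>
                length us = Suc t \<and> set us \<subseteq> act_set S \<longrightarrow>
        obs_next S t ws us \<in> obs_set S \<and> cost_fun S t ws us \<in> cost_set S)"

text \<open>Observations and costs produced by a sample point under an action sequence, of which
  \<open>observation S \<omega> u t\<close> uses only the entries before time \<open>t\<close> and \<open>incurred_cost S \<omega> u t\<close>
  only those up to time \<open>t\<close>. A finite action list \<open>us\<close> is used as the sequence \<open>(!) us\<close>.\<close>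

primrec observation :: "('o, 'e) control_system \<Rightarrow> 'o \<Rightarrow> (nat \<Rightarrow> 'e) \<Rightarrow> nat \<Rightarrow> 'e" where
  "observation S \<omega> u 0 = obs_init S (disturbance S 0 \<omega>)"
| "observation S \<omega> u (Suc t) =
     obs_next S t (map (\<lambda>i. disturbance S i \<omega>) [0..<Suc t]) (map u [0..<Suc t])"

definition incurred_cost :: "('o, 'e) control_system \<Rightarrow> 'o \<Rightarrow> (nat \<Rightarrow> 'e) \<Rightarrow> nat \<Rightarrow> real" where
  "incurred_cost S \<omega> u t =
     cost_fun S t (map (\<lambda>i. disturbance S i \<omega>) [0..<Suc t]) (map u [0..<Suc t])"

text \<open>A memory realization at time \<open>t\<close> is \<open>(y\<^bsub>0:t\<^esub>, c\<^bsub>0:t-1\<^esub>, u\<^bsub>0:t-1\<^esub>)\<close>.\<close>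

type_synonym 'e memory = "'e list \<times> real list \<times> 'e list"

definition memory_space :: "('o, 'e) control_system \<Rightarrow> nat \<Rightarrow> 'e memory set" where
  "memory_space S t =
     {(ys, cs, us). length ys = Suc t \<and> set ys \<subseteq> obs_set S \<and>
                    length cs = t \<and> set cs \<subseteq> cost_set S \<and>
                    length us = t \<and> set us \<subseteq> act_set S}"

definition mem_acts :: "'e memory \<Rightarrow> 'e list" where
  "mem_acts m = snd (snd m)"

definition memory_at :: "('o, 'e) control_system \<Rightarrow> 'o \<Rightarrow> (nat \<Rightarrow> 'e) \<Rightarrow> nat \<Rightarrow> 'e memory" where
  "memory_at S \<omega> u t =
     (map (observation S \<omega> u) [0..<Suc t], map (incurred_cost S \<omega> u) [0..<t], map u [0..<t])"

text \<open>The sample points over which ranges conditioned on \<open>m\<^sub>t\<close> are taken.\<close>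

definition consistent :: "('o, 'e) control_system \<Rightarrow> nat \<Rightarrow> 'e memory \<Rightarrow> 'o set" where
  "consistent S t m = {\<omega> \<in> sample_space S. memory_at S \<omega> ((!) (mem_acts m)) t = m}"

definition feasible :: "('o, 'e) control_system \<Rightarrow> nat \<Rightarrow> 'e memory \<Rightarrow> bool" where
  "feasible S t m \<longleftrightarrow> m \<in> memory_space S t \<and> consistent S t m \<noteq> {}"

type_synonym 'e strategy = "nat \<Rightarrow> 'e memory \<Rightarrow> 'e"

text \<open>Values of \<open>g t\<close> outside \<open>memory_space S t\<close> are arbitrary and never used.\<close>

definition strategies :: "('o, 'e) control_system \<Rightarrow> 'e strategy set" where
  "strategies S = {g. \<forall>t. g t \<in> memory_space S t \<rightarrow> act_set S}"

text \<open>The actions \<open>us\<close> taken so far, followed by the next \<open>n\<close> actions generated by \<open>g\<close>.\<close>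

primrec extend_acts ::
    "('o, 'e) control_system \<Rightarrow> 'e strategy \<Rightarrow> 'o \<Rightarrow> 'e list \<Rightarrow> nat \<Rightarrow> 'e list" where
  "extend_acts S g \<omega> us 0 = us"
| "extend_acts S g \<omega> us (Suc n) =
     (let us' = extend_acts S g \<omega> us n
      in us' @ [g (length us') (memory_at S \<omega> ((!) us') (length us'))])"

text \<open>The infinite action sequence that starts with \<open>us\<close> and is generated by \<open>g\<close> afterwards; the
  list below has length \<open>length us + Suc t\<close>, so its entry at \<open>t\<close> is defined.\<close>

definition closed_loop ::
    "('o, 'e) control_system \<Rightarrow> 'e strategy \<Rightarrow> 'o \<Rightarrow> 'e list \<Rightarrow> nat \<Rightarrow> 'e" where
  "closed_loop S g \<omega> us t = extend_acts S g \<omega> us (Suc t) ! t"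

definition accrued_cost ::
    "('o, 'e) control_system \<Rightarrow> real \<Rightarrow> 'o \<Rightarrow> (nat \<Rightarrow> 'e) \<Rightarrow> nat \<Rightarrow> real" where
  "accrued_cost S \<gamma> \<omega> u t = (\<Sum>l<t. \<gamma> ^ l * incurred_cost S \<omega> u l)"

definition cost_to_go ::
    "('o, 'e) control_system \<Rightarrow> real \<Rightarrow> 'o \<Rightarrow> (nat \<Rightarrow> 'e) \<Rightarrow> nat \<Rightarrow> real" where
  "cost_to_go S \<gamma> \<omega> u t = (\<Sum>k. \<gamma> ^ k * incurred_cost S \<omega> u (t + k))"

text \<open>The conditional range \<open>[[A\<^sub>t, C\<^sub>t\<^sup>\<infinity> | m\<^sub>t]]\<close> under the strategy \<open>g\<close>.\<close>

definition cost_range ::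
    "('o, 'e) control_system \<Rightarrow> real \<Rightarrow> 'e strategy \<Rightarrow> nat \<Rightarrow> 'e memory \<Rightarrow> (real \<times> real) set" where
  "cost_range S \<gamma> g t m =
     (\<lambda>\<omega>. let u = closed_loop S g \<omega> (mem_acts m)
          in (accrued_cost S \<gamma> \<omega> u t, cost_to_go S \<gamma> \<omega> u t)) ` consistent S t m"

definition strategy_value ::
    "('o, 'e) control_system \<Rightarrow> real \<Rightarrow> 'e strategy \<Rightarrow> nat \<Rightarrow> 'e memory \<Rightarrow> real" where
  "strategy_value S \<gamma> g t m = (SUP (a, c)\<in>cost_range S \<gamma> g t m. a + \<gamma> ^ t * c)"

definition optimal_value ::
    "('o, 'e) control_system \<Rightarrow> real \<Rightarrow> nat \<Rightarrow> 'e memory \<Rightarrow> real" where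
  "optimal_value S \<gamma> t m = (INF g\<in>strategies S. strategy_value S \<gamma> g t m)"

text \<open>\<open>mem_range S \<sigma> t m u\<close> is \<open>[[C\<^sub>t, S\<^bsub>t+1\<^esub> | m\<^sub>t, u\<^sub>t]]\<close> and \<open>info_range S \<sigma> t s u\<close> is
  \<open>[[C\<^sub>t, S\<^bsub>t+1\<^esub> | s, u]]\<close>, where \<open>S\<^sub>t = \<sigma>\<^sub>t(M\<^sub>t)\<close>.\<close>

definition mem_range ::
    "('o, 'e) control_system \<Rightarrow> (nat \<Rightarrow> 'e memory \<Rightarrow> 's) \<Rightarrow> nat \<Rightarrow> 'e memory \<Rightarrow> 'e \<Rightarrow> (real \<times> 's) set"
  where
  "mem_range S \<sigma> t m u =
     (\<lambda>\<omega>. let us = (!) (mem_acts m @ [u])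
          in (incurred_cost S \<omega> us t, \<sigma> (Suc t) (memory_at S \<omega> us (Suc t)))) ` consistent S t m"

definition info_range ::
    "('o, 'e) control_system \<Rightarrow> (nat \<Rightarrow> 'e memory \<Rightarrow> 's) \<Rightarrow> nat \<Rightarrow> 's \<Rightarrow> 'e \<Rightarrow> (real \<times> 's) set"
  where
  "info_range S \<sigma> t s u = (\<Union>m\<in>{m. feasible S t m \<and> \<sigma> t m = s}. mem_range S \<sigma> t m u)"

text \<open>\<open>R s u\<close> is the time-invariant conditional range \<open>[[C, S' | s, u]]\<close>; at points \<open>s\<close> that are
  never the value of a feasible memory it is an arbitrary nonempty subset.\<close>

definition approx_info_state ::
    "('o, 'e) control_system \<Rightarrow> real \<Rightarrow> 's::metric_space set \<Rightarrow> (nat \<Rightarrow> 'e memory \<Rightarrow> 's) \<Rightarrow>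
     ('s \<Rightarrow> 'e \<Rightarrow> (real \<times> 's) set) \<Rightarrow> bool" where
  "approx_info_state S \<epsilon> Shat \<sigma> R \<longleftrightarrow>
     bounded Shat \<and>
     (\<forall>t. \<sigma> t \<in> memory_space S t \<rightarrow> Shat) \<and>
     (\<forall>t m u. feasible S t m \<and> u \<in> act_set S \<longrightarrow>
        hausdorff_distance sum_dist (mem_range S \<sigma> t m u) (info_range S \<sigma> t (\<sigma> t m) u) \<le> \<epsilon>) \<and>
     (\<forall>s\<in>Shat. \<forall>u\<in>act_set S. R s u \<noteq> {} \<and> R s u \<subseteq> cost_set S \<times> Shat) \<and>
     (\<forall>t m u. feasible S t m \<and> u \<in> act_set S \<longrightarrow>
        info_range S \<sigma> t (\<sigma> t m) u = R (\<sigma> t m) u)"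

definition worst_case ::
    "real \<Rightarrow> ('s \<Rightarrow> 'e \<Rightarrow> (real \<times> 's) set) \<Rightarrow> ('s \<Rightarrow> real) \<Rightarrow> 's \<Rightarrow> 'e \<Rightarrow> real" where
  "worst_case \<gamma> R \<Lambda> s u = (SUP (c, s')\<in>R s u. c + \<gamma> * \<Lambda> s')"

definition dp_operator ::
    "'e set \<Rightarrow> real \<Rightarrow> ('s \<Rightarrow> 'e \<Rightarrow> (real \<times> 's) set) \<Rightarrow> ('s \<Rightarrow> real) \<Rightarrow> 's \<Rightarrow> real" where
  "dp_operator U \<gamma> R \<Lambda> s = (INF u\<in>U. worst_case \<gamma> R \<Lambda> s u)"

definition dp_iterate ::
    "'e set \<Rightarrow> real \<Rightarrow> ('s \<Rightarrow> 'e \<Rightarrow> (real \<times> 's) set) \<Rightarrow> nat \<Rightarrow> 's \<Rightarrow> real" where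
  "dp_iterate U \<gamma> R n = (dp_operator U \<gamma> R ^^ n) (\<lambda>_. 0)"

text \<open>The pointwise limit of the iterates. On \<open>Shat\<close> the operator is a sup-norm contraction, so there
  the convergence is uniform and the limit is the unique bounded fixed point.\<close>

definition dp_limit ::
    "'e set \<Rightarrow> real \<Rightarrow> ('s \<Rightarrow> 'e \<Rightarrow> (real \<times> 's) set) \<Rightarrow> 's \<Rightarrow> real" where
  "dp_limit U \<gamma> R s = lim (\<lambda>n. dp_iterate U \<gamma> R n s)"

definition inf_attained ::
    "'e set \<Rightarrow> real \<Rightarrow> ('s \<Rightarrow> 'e \<Rightarrow> (real \<times> 's) set) \<Rightarrow> 's set \<Rightarrow> ('s \<Rightarrow> real) \<Rightarrow> bool" where
  "inf_attained U \<gamma> R Shat \<Lambda> \<longleftrightarrow>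
     (\<forall>s\<in>Shat. \<exists>u\<in>U. worst_case \<gamma> R \<Lambda> s u = dp_operator U \<gamma> R \<Lambda> s)"

end

theory Submission
  imports Defs
begin

text \<open>The value of a strategy is the supremum of the discounted cost over the sample points consistent with
  the initial observation. Costs are observed, so the memory at time \<open>t+1\<close> determines the cost at
  time \<open>t\<close>: the sample points consistent with a successor memory share the stage cost, and the
  cost-to-go can be analysed one step at a time, with \<open>\<Lambda>\<close>, the fixed point of the
  dynamic program, compared to it after each step. Write \<open>s\<close> for the value of the approximate
  information state at the memory \<open>m\<close>.

  From above: the range of stage cost and next state given \<open>m\<close> and \<open>u\<close> lies inside the range
  \<open>R s u\<close> that the dynamic program maximises over. Acting greedily for \<open>\<Lambda>\<close> therefore
  costs at most \<open>\<Lambda> s\<close> along every trajectory. If no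
  minimiser exists, actions that are optimal up to \<open>\<delta>\<close> lose at most \<open>\<delta> / (1 - \<gamma>)\<close>
  in total (\<open>future_cost_upper_bound\<close>).

  From below: given any strategy, the action it takes at \<open>m\<close> admits a pair in \<open>R s u\<close> whose
  cost plus discounted \<open>\<Lambda>\<close> is almost \<open>\<Lambda> s\<close>. Some sample point consistent with \<open>m\<close>
  produces a pair at distance at most \<open>\<epsilon>\<close> from it, up to arbitrarily small slack, and \<open>(c, s') \<mapsto> c + \<gamma> * \<Lambda> s'\<close> is Lipschitz
  with constant \<open>max (\<gamma> * L) 1\<close> for the sum metric, which bounds the loss in one step
  (\<open>bad_sample_point\<close>). An adversary who repeats this choice loses that amount, discounted, at
  every step: a geometric series with sum \<open>max (\<gamma> * L) 1 * \<epsilon> / (1 - \<gamma>)\<close>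
  (\<open>future_cost_lower_bound\<close>).

  Hence \<open>\<Lambda> s - max (\<gamma> * L) 1 * \<epsilon> / (1 - \<gamma>) \<le> V \<le> \<Lambda> s\<close> holds at the initial memory, both for the
  optimal value and for the value of the greedy strategy, which gives the two claims. Both bounds on
  the cost-to-go are proved by induction on the number \<open>n\<close> of steps followed, with an error
  \<open>\<gamma>\<^sup>n\<close> times a bound on all values for the unseen tail, and then \<open>n \<rightarrow> \<infinity>\<close>.\<close>

section \<open>The dynamic program on the approximate information states\<close>

locale bounded_dp =
  fixes U :: "'e set" and \<gamma> :: real and R :: "'s \<Rightarrow> 'e \<Rightarrow> (real \<times> 's) set"
    and X :: "'s set" and C :: real
  assumes actions_nonempty: "U \<noteq> {}"
    and discount: "0 < \<gamma>" "\<gamma> < 1"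
    and cost_bound_nonneg: "0 \<le> C"
    and successors_nonempty: "\<And>s u. s \<in> X \<Longrightarrow> u \<in> U \<Longrightarrow> R s u \<noteq> {}"
    and successors_subset: "\<And>s u. s \<in> X \<Longrightarrow> u \<in> U \<Longrightarrow> R s u \<subseteq> {0..C} \<times> X"
begin

abbreviation value_bound :: real where
  "value_bound \<equiv> C / (1 - \<gamma>)"

lemma value_bound_nonneg: "0 \<le> value_bound"
  using cost_bound_nonneg discount by simp

lemma value_bound_unfold: "C + \<gamma> * value_bound = value_bound"
  using discount by (simp add: field_simps)

lemma worst_case_upper:
  assumes s: "s \<in> X" and u: "u \<in> U" and f: "\<And>x. x \<in> X \<Longrightarrow> f x \<le> b"
    and mem: "(c, s') \<in> R s u"
  shows "c + \<gamma> * f s' \<le> worst_case \<gamma> R f s u"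
proof -
  have "bdd_above ((\<lambda>(c, s'). c + \<gamma> * f s') ` R s u)"
  proof (rule bdd_aboveI2)
    fix x assume "x \<in> R s u"
    with successors_subset[OF s u] have "fst x \<le> C" "snd x \<in> X" by auto
    moreover from this have "\<gamma> * f (snd x) \<le> \<gamma> * b"
      using discount f by (intro mult_left_mono) auto
    ultimately show "(case x of (c, s') \<Rightarrow> c + \<gamma> * f s') \<le> C + \<gamma> * b"
      by (simp add: case_prod_beta)
  qed
  from cSUP_upper[OF mem this] show ?thesis by (simp add: worst_case_def)
qed

lemma worst_case_least:
  assumes "s \<in> X" "u \<in> U" and "\<And>c s'. (c, s') \<in> R s u \<Longrightarrow> c + \<gamma> * f s' \<le> b"
  shows "worst_case \<gamma> R f s u \<le> b"
  unfolding worst_case_def using assms successors_nonempty by (intro cSUP_least) auto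

text \<open>Monotonicity and discounting of constants in one estimate: with \<open>d = 0\<close> it is
  monotonicity, and with a constant \<open>d\<close> it gives the contraction. The same form for the operator
  below compares the iterates with each other and with their limit.\<close>

lemma worst_case_shift:
  assumes s: "s \<in> X" and u: "u \<in> U" and g: "\<And>x. x \<in> X \<Longrightarrow> g x \<le> b"
    and fg: "\<And>x. x \<in> X \<Longrightarrow> f x \<le> g x + d"
  shows "worst_case \<gamma> R f s u \<le> worst_case \<gamma> R g s u + \<gamma> * d"
proof (rule worst_case_least[OF s u])
  fix c s' assume cs: "(c, s') \<in> R s u"
  then have "s' \<in> X" using successors_subset[OF s u] by auto
  then have "\<gamma> * f s' \<le> \<gamma> * (g s' + d)" using fg discount by (intro mult_left_mono) auto
  then show "c + \<gamma> * f s' \<le> worst_case \<gamma> R g s u + \<gamma> * d"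
    using worst_case_upper[where f=g, OF s u g cs] by (simp add: algebra_simps)
qed

lemma worst_case_nonneg:
  assumes s: "s \<in> X" and u: "u \<in> U" and f: "\<And>x. x \<in> X \<Longrightarrow> 0 \<le> f x \<and> f x \<le> b"
  shows "0 \<le> worst_case \<gamma> R f s u"
proof -
  obtain c s' where cs: "(c, s') \<in> R s u" using successors_nonempty[OF s u] by fastforce
  then have "0 \<le> c" "s' \<in> X" using successors_subset[OF s u] by auto
  then have "0 \<le> c + \<gamma> * f s'" using f discount by simp
  also have "\<dots> \<le> worst_case \<gamma> R f s u"
    using worst_case_upper[OF s u _ cs, of f b] f by auto
  finally show ?thesis .
qed

lemma dp_operator_lower:
  assumes s: "s \<in> X" and u: "u \<in> U" and f: "\<And>x. x \<in> X \<Longrightarrow> 0 \<le> f x \<and> f x \<le> b"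
  shows "dp_operator U \<gamma> R f s \<le> worst_case \<gamma> R f s u"
proof -
  have "bdd_below (worst_case \<gamma> R f s ` U)"
    using worst_case_nonneg[where f=f, OF s _ f] by (intro bdd_belowI2[where m=0]) auto
  from cINF_lower[OF this u] show ?thesis by (simp add: dp_operator_def)
qed

lemma dp_operator_greatest:
  assumes "\<And>u. u \<in> U \<Longrightarrow> b \<le> worst_case \<gamma> R f s u"
  shows "b \<le> dp_operator U \<gamma> R f s"
  unfolding dp_operator_def using assms actions_nonempty by (intro cINF_greatest) auto

lemma dp_operator_shift:
  assumes s: "s \<in> X"
    and f: "\<And>x. x \<in> X \<Longrightarrow> 0 \<le> f x \<and> f x \<le> b" and g: "\<And>x. x \<in> X \<Longrightarrow> g x \<le> b'"
    and fg: "\<And>x. x \<in> X \<Longrightarrow> f x \<le> g x + d"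
  shows "dp_operator U \<gamma> R f s \<le> dp_operator U \<gamma> R g s + \<gamma> * d"
proof -
  have "dp_operator U \<gamma> R f s - \<gamma> * d \<le> dp_operator U \<gamma> R g s"
  proof (rule dp_operator_greatest)
    fix u assume u: "u \<in> U"
    show "dp_operator U \<gamma> R f s - \<gamma> * d \<le> worst_case \<gamma> R g s u"
      using dp_operator_lower[where f=f, OF s u f] worst_case_shift[where f=f and g=g, OF s u g fg]
      by fastforce
  qed
  then show ?thesis by simp
qed

lemma dp_iterate_0: "dp_iterate U \<gamma> R 0 s = 0"
  by (simp add: dp_iterate_def)

lemma dp_iterate_Suc: "dp_iterate U \<gamma> R (Suc n) = dp_operator U \<gamma> R (dp_iterate U \<gamma> R n)"
  by (simp add: dp_iterate_def)

lemma dp_iterate_bounds: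
  "s \<in> X \<Longrightarrow> 0 \<le> dp_iterate U \<gamma> R n s \<and> dp_iterate U \<gamma> R n s \<le> value_bound"
proof (induction n arbitrary: s)
  case 0
  then show ?case using value_bound_nonneg by (simp add: dp_iterate_0)
next
  case (Suc n)
  obtain u where u: "u \<in> U" using actions_nonempty by auto
  have "worst_case \<gamma> R (dp_iterate U \<gamma> R n) s u \<le> value_bound"
  proof (rule worst_case_least[OF Suc.prems u])
    fix c s' assume "(c, s') \<in> R s u"
    with successors_subset[OF Suc.prems u] have "c \<le> C" "s' \<in> X" by auto
    moreover from this have "\<gamma> * dp_iterate U \<gamma> R n s' \<le> \<gamma> * value_bound"
      using Suc.IH discount by (intro mult_left_mono) auto
    ultimately show "c + \<gamma> * dp_iterate U \<gamma> R n s' \<le> value_bound"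
      using value_bound_unfold by linarith
  qed
  with dp_operator_lower[where f="dp_iterate U \<gamma> R n", OF Suc.prems u Suc.IH]
  have "dp_operator U \<gamma> R (dp_iterate U \<gamma> R n) s \<le> value_bound" by simp
  moreover have "0 \<le> dp_operator U \<gamma> R (dp_iterate U \<gamma> R n) s"
    by (rule dp_operator_greatest) (rule worst_case_nonneg[where f="dp_iterate U \<gamma> R n", OF Suc.prems _ Suc.IH])
  ultimately show ?case by (simp add: dp_iterate_Suc)
qed

text \<open>Costs are nonnegative, so \<open>0\<close> lies below every iterate, and the monotone operator
  carries this comparison from stage \<open>0\<close> to stage \<open>n\<close>. The next lemma carries the
  upper bound \<open>value_bound\<close> along in the same way, shrinking by \<open>\<gamma>\<close> at each stage.\<close>

lemma dp_iterate_mono: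
  "s \<in> X \<Longrightarrow> dp_iterate U \<gamma> R n s \<le> dp_iterate U \<gamma> R (n + k) s"
proof (induction n arbitrary: s)
  case 0
  then show ?case using dp_iterate_bounds by (simp add: dp_iterate_0)
next
  case (Suc n)
  show ?case
    using dp_operator_shift[where f="dp_iterate U \<gamma> R n" and g="dp_iterate U \<gamma> R (n + k)"
        and b=value_bound and b'=value_bound and d=0, OF Suc.prems]
      dp_iterate_bounds Suc.IH by (simp add: dp_iterate_Suc)
qed

lemma dp_iterate_tail:
  "s \<in> X \<Longrightarrow> dp_iterate U \<gamma> R (n + k) s \<le> dp_iterate U \<gamma> R n s + \<gamma> ^ n * value_bound"
proof (induction n arbitrary: s)
  case 0
  then show ?case using dp_iterate_bounds by (simp add: dp_iterate_0)
next
  case (Suc n)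
  show ?case
    using dp_operator_shift[where f="dp_iterate U \<gamma> R (n + k)" and g="dp_iterate U \<gamma> R n"
        and b=value_bound and b'=value_bound and d="\<gamma> ^ n * value_bound", OF Suc.prems]
      dp_iterate_bounds Suc.IH by (simp add: dp_iterate_Suc mult.assoc)
qed

lemma dp_iterate_tendsto:
  assumes "s \<in> X"
  shows "(\<lambda>n. dp_iterate U \<gamma> R n s) \<longlonglongrightarrow> dp_limit U \<gamma> R s"
proof -
  have inc: "incseq (\<lambda>n. dp_iterate U \<gamma> R n s)"
    using dp_iterate_mono[OF assms] by (intro incseq_SucI) (metis Suc_eq_plus1)
  have "convergent (\<lambda>n. dp_iterate U \<gamma> R n s)"
    by (rule Bseq_mono_convergent[OF BseqI'[where K=value_bound]])
      (use dp_iterate_bounds[OF assms] inc in \<open>auto simp: incseq_def\<close>)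
  then show ?thesis by (simp add: dp_limit_def convergent_LIMSEQ_iff)
qed

lemma dp_limit_bounds:
  assumes "s \<in> X"
  shows "0 \<le> dp_limit U \<gamma> R s \<and> dp_limit U \<gamma> R s \<le> value_bound"
  using dp_iterate_bounds[OF assms] dp_iterate_tendsto[OF assms]
  by (meson LIMSEQ_le_const LIMSEQ_le_const2)

lemma dp_limit_sandwich:
  assumes "s \<in> X"
  shows "dp_iterate U \<gamma> R n s \<le> dp_limit U \<gamma> R s"
    and "dp_limit U \<gamma> R s \<le> dp_iterate U \<gamma> R n s + \<gamma> ^ n * value_bound"
proof -
  have lim: "(\<lambda>k. dp_iterate U \<gamma> R (n + k) s) \<longlonglongrightarrow> dp_limit U \<gamma> R s"
    using LIMSEQ_ignore_initial_segment[OF dp_iterate_tendsto[OF assms], of n]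
    by (simp add: add.commute)
  show "dp_iterate U \<gamma> R n s \<le> dp_limit U \<gamma> R s"
    using dp_iterate_mono[OF assms] by (intro LIMSEQ_le_const[OF lim]) auto
  show "dp_limit U \<gamma> R s \<le> dp_iterate U \<gamma> R n s + \<gamma> ^ n * value_bound"
    using dp_iterate_tail[OF assms] by (intro LIMSEQ_le_const2[OF lim]) auto
qed

text \<open>Applying the operator to the sandwich of \<open>\<Lambda>\<^sup>\<infinity>\<close> between \<open>\<Lambda>\<^sup>n\<close> and
  \<open>\<Lambda>\<^sup>n + \<gamma>\<^sup>n * value_bound\<close> sandwiches its image between bounds that both tend to
  \<open>\<Lambda>\<^sup>\<infinity>\<close>.\<close>

lemma dp_limit_fixed_point:
  assumes s: "s \<in> X"
  shows "dp_operator U \<gamma> R (dp_limit U \<gamma> R) s = dp_limit U \<gamma> R s"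
proof -
  let ?T = "dp_operator U \<gamma> R (dp_limit U \<gamma> R) s"
  have low: "dp_iterate U \<gamma> R (Suc n) s \<le> ?T" for n
    using dp_operator_shift[where f="dp_iterate U \<gamma> R n" and g="dp_limit U \<gamma> R"
        and b=value_bound and b'=value_bound and d=0, OF s]
      dp_iterate_bounds dp_limit_bounds dp_limit_sandwich by (simp add: dp_iterate_Suc)
  have up: "?T \<le> dp_iterate U \<gamma> R (Suc n) s + \<gamma> ^ Suc n * value_bound" for n
    using dp_operator_shift[where f="dp_limit U \<gamma> R" and g="dp_iterate U \<gamma> R n"
        and b=value_bound and b'=value_bound and d="\<gamma> ^ n * value_bound", OF s]
      dp_iterate_bounds dp_limit_bounds dp_limit_sandwich by (simp add: dp_iterate_Suc mult.assoc)
  have lim: "(\<lambda>n. dp_iterate U \<gamma> R (Suc n) s) \<longlonglongrightarrow> dp_limit U \<gamma> R s"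
    using dp_iterate_tendsto[OF s] by (rule LIMSEQ_Suc)
  have "(\<lambda>n. \<gamma> ^ n) \<longlonglongrightarrow> 0" using discount by (intro LIMSEQ_power_zero) auto
  then have "(\<lambda>n. \<gamma> ^ Suc n) \<longlonglongrightarrow> 0" by (rule LIMSEQ_Suc)
  from tendsto_add[OF lim tendsto_mult_right[OF this, of value_bound]]
  have lim': "(\<lambda>n. dp_iterate U \<gamma> R (Suc n) s + \<gamma> ^ Suc n * value_bound) \<longlonglongrightarrow> dp_limit U \<gamma> R s"
    by simp
  have "dp_limit U \<gamma> R s \<le> ?T" using low by (intro LIMSEQ_le_const2[OF lim]) auto
  moreover have "?T \<le> dp_limit U \<gamma> R s" using up by (intro LIMSEQ_le_const[OF lim']) blast
  ultimately show ?thesis by simp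
qed

end

lemma lipschitz_on_pointwise_limit:
  fixes f :: "nat \<Rightarrow> 'a::metric_space \<Rightarrow> 'b::metric_space"
  assumes lip: "\<And>n. L-lipschitz_on X (f n)"
    and lim: "\<And>x. x \<in> X \<Longrightarrow> (\<lambda>n. f n x) \<longlonglongrightarrow> g x"
  shows "L-lipschitz_on X g"
proof (rule lipschitz_onI)
  fix x y assume x: "x \<in> X" and y: "y \<in> X"
  show "dist (g x) (g y) \<le> L * dist x y"
    by (rule LIMSEQ_le_const2[OF tendsto_dist[OF lim[OF x] lim[OF y]]])
      (use lipschitz_onD[OF lip x y] in auto)
qed (rule lipschitz_on_nonneg[OF lip])

section \<open>Near points of sets at small Hausdorff distance\<close>

text \<open>Real suprema and infima carry information only on bounded sets; the bound \<open>D\<close> ensures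
  that the one-sided distance inside \<open>hausdorff_distance\<close> is a genuine supremum. The infimum need
  not be attained, hence the strict slack \<open>\<epsilon> < \<delta>\<close>.\<close>

lemma hausdorff_distance_approx:
  assumes P: "P \<noteq> {}" and q: "q \<in> Q"
    and nonneg: "\<And>p q. p \<in> P \<Longrightarrow> q \<in> Q \<Longrightarrow> 0 \<le> \<eta> p q"
    and bound: "\<And>p q. p \<in> P \<Longrightarrow> q \<in> Q \<Longrightarrow> \<eta> p q \<le> D"
    and close: "hausdorff_distance \<eta> P Q \<le> \<epsilon>" and "\<epsilon> < \<delta>"
  shows "\<exists>p\<in>P. \<eta> p q < \<delta>"
proof -
  obtain p0 where p0: "p0 \<in> P" using P by auto
  have below: "bdd_below ((\<lambda>p. \<eta> p q) ` P)" if "q \<in> Q" for q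
    using nonneg that by (intro bdd_belowI2[where m=0]) auto
  have "bdd_above ((\<lambda>q. INF p\<in>P. \<eta> p q) ` Q)"
    using cINF_lower[OF below p0] bound[OF p0] by (intro bdd_aboveI2[where M=D]) fastforce
  from cSUP_upper[OF q this] have "(INF p\<in>P. \<eta> p q) \<le> \<epsilon>"
    using close by (simp add: hausdorff_distance_def)
  then have "(INF p\<in>P. \<eta> p q) < \<delta>" using \<open>\<epsilon> < \<delta>\<close> by simp
  then show ?thesis using cINF_less_iff[OF P below[OF q]] by auto
qed

section \<open>Closed-loop trajectories\<close>

lemma memory_at_cong:
  assumes "\<And>i. i < t \<Longrightarrow> u i = v i"
  shows "memory_at S \<omega> u t = memory_at S \<omega> v t"
proof -
  have "observation S \<omega> u i = observation S \<omega> v i" if "i < Suc t" for i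
  proof (cases i)
    case (Suc j)
    have "map u [0..<Suc j] = map v [0..<Suc j]" using assms that Suc by (intro map_cong) auto
    then show ?thesis by (simp only: Suc observation.simps)
  qed simp
  moreover have "incurred_cost S \<omega> u i = incurred_cost S \<omega> v i" if "i < t" for i
  proof -
    have "map u [0..<Suc i] = map v [0..<Suc i]" using assms that by (intro map_cong) auto
    then show ?thesis by (simp only: incurred_cost_def)
  qed
  ultimately show ?thesis unfolding memory_at_def using assms
    by (intro conjI prod_eqI) (auto intro!: map_cong simp del: upt_Suc)
qed

lemma length_extend_acts [simp]: "length (extend_acts S g \<omega> us n) = length us + n"
  by (induction n) (auto simp: Let_def)

lemma nth_extend_acts_mono:
  "m \<le> n \<Longrightarrow> i < length us + m \<Longrightarrow> extend_acts S g \<omega> us n ! i = extend_acts S g \<omega> us m ! i"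
  by (induction n rule: dec_induct) (auto simp: Let_def nth_append)

lemma nth_extend_acts:
  assumes "i < length us + n"
  shows "extend_acts S g \<omega> us n ! i = closed_loop S g \<omega> us i"
  unfolding closed_loop_def
  using nth_extend_acts_mono[of n "Suc i" i us S g \<omega>] nth_extend_acts_mono[of "Suc i" n i us S g \<omega>]
    assms by (cases "n \<le> Suc i") auto

lemma closed_loop_past: "i < length us \<Longrightarrow> closed_loop S g \<omega> us i = us ! i"
  using nth_extend_acts[of i us 0 S g \<omega>] by simp

lemma closed_loop_future:
  assumes "length us \<le> i"
  shows "closed_loop S g \<omega> us i = g i (memory_at S \<omega> (closed_loop S g \<omega> us) i)"
proof -
  obtain n where n: "i = length us + n" using assms by (metis le_add_diff_inverse)
  have "closed_loop S g \<omega> us i = extend_acts S g \<omega> us (Suc n) ! i"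
    using n by (intro nth_extend_acts[symmetric]) simp
  also have "\<dots> = g i (memory_at S \<omega> ((!) (extend_acts S g \<omega> us n)) i)"
    using n by (simp add: Let_def nth_append)
  also have "memory_at S \<omega> ((!) (extend_acts S g \<omega> us n)) i
      = memory_at S \<omega> (closed_loop S g \<omega> us) i"
    using n by (intro memory_at_cong nth_extend_acts) simp
  finally show ?thesis .
qed

text \<open>The closed loop is determined by its fixed-point equation because the memory at time \<open>i\<close>
  uses only the actions before \<open>i\<close>. This replaces the recursion over action lists in what
  follows: to identify a closed loop it suffices to check the equation.\<close>

lemma closed_loop_unique:
  assumes past: "\<And>i. i < length us \<Longrightarrow> u i = us ! i"
    and future: "\<And>i. length us \<le> i \<Longrightarrow> u i = g i (memory_at S \<omega> u i)"
  shows "closed_loop S g \<omega> us = u"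
proof
  fix i show "closed_loop S g \<omega> us i = u i"
  proof (induction i rule: less_induct)
    case (less i)
    show ?case
    proof (cases "i < length us")
      case True
      then show ?thesis by (simp add: past closed_loop_past)
    next
      case False
      then show ?thesis
        using memory_at_cong[of i "closed_loop S g \<omega> us" u S \<omega>] less
        by (simp add: closed_loop_future future)
    qed
  qed
qed

lemma closed_loop_snoc:
  "closed_loop S g \<omega> (us @ [closed_loop S g \<omega> us (length us)]) = closed_loop S g \<omega> us"
  by (rule closed_loop_unique) (auto simp: closed_loop_past closed_loop_future nth_append less_Suc_eq)

lemma mem_acts_memory_at [simp]: "mem_acts (memory_at S \<omega> u t) = map u [0..<t]"
  by (simp add: memory_at_def mem_acts_def)

lemma memory_at_Suc_eqD:
  assumes "memory_at S \<omega> u (Suc t) = memory_at S \<omega>' u (Suc t)"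
  shows "memory_at S \<omega> u t = memory_at S \<omega>' u t"
    and "incurred_cost S \<omega> u t = incurred_cost S \<omega>' u t"
  using assms by (auto simp: memory_at_def)

section \<open>Trajectories of a control problem\<close>

locale controlled =
  fixes S :: "('o, 'e::metric_space) control_system" and \<gamma> :: real and cmax :: real
  assumes problem: "control_problem S"
    and discount: "0 < \<gamma>" "\<gamma> < 1"
    and cost_set_bounds: "cost_set S \<subseteq> {0..cmax}"
begin

lemma stage_in_range:
  assumes "\<omega> \<in> sample_space S" and "\<And>i. i \<le> t \<Longrightarrow> u i \<in> act_set S"
  shows "observation S \<omega> u (Suc t) \<in> obs_set S" and "incurred_cost S \<omega> u t \<in> cost_set S"
proof -
  have d: "set (map (\<lambda>i. disturbance S i \<omega>) [0..<Suc t]) \<subseteq> dist_set S"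
    using problem assms(1) by (auto simp: control_problem_def Pi_iff simp del: upt_Suc)
  have a: "set (map u [0..<Suc t]) \<subseteq> act_set S" using assms(2) by (auto simp del: upt_Suc)
  have "obs_next S t (map (\<lambda>i. disturbance S i \<omega>) [0..<Suc t]) (map u [0..<Suc t]) \<in> obs_set S \<and>
      cost_fun S t (map (\<lambda>i. disturbance S i \<omega>) [0..<Suc t]) (map u [0..<Suc t]) \<in> cost_set S"
    using problem d a unfolding control_problem_def by (simp del: upt_Suc)
  then show "observation S \<omega> u (Suc t) \<in> obs_set S" "incurred_cost S \<omega> u t \<in> cost_set S"
    by (simp_all only: observation.simps incurred_cost_def)
qed

lemma memory_at_in_space:
  assumes w: "\<omega> \<in> sample_space S" and u: "\<And>i. i < t \<Longrightarrow> u i \<in> act_set S"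
  shows "memory_at S \<omega> u t \<in> memory_space S t"
proof -
  have "observation S \<omega> u i \<in> obs_set S" if "i < Suc t" for i
  proof (cases i)
    case 0
    then show ?thesis using problem w by (auto simp: control_problem_def Pi_iff)
  next
    case (Suc j)
    then show ?thesis using stage_in_range(1)[OF w, of j u] u that by simp
  qed
  moreover have "incurred_cost S \<omega> u i \<in> cost_set S" if "i < t" for i
    using stage_in_range(2)[OF w, of i u] u that by simp
  ultimately show ?thesis using u
    by (auto simp: memory_at_def memory_space_def simp del: upt_Suc)
qed

lemma closed_loop_in_act_set:
  assumes g: "g \<in> strategies S" and w: "\<omega> \<in> sample_space S" and us: "set us \<subseteq> act_set S"
  shows "closed_loop S g \<omega> us i \<in> act_set S"
proof (induction i rule: less_induct)
  case (less i)
  show ?case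
  proof (cases "i < length us")
    case True
    then show ?thesis using us by (auto simp: closed_loop_past)
  next
    case False
    then show ?thesis using g memory_at_in_space[where u="closed_loop S g \<omega> us", OF w less]
      by (auto simp: closed_loop_future strategies_def)
  qed
qed

abbreviation future_cost :: "'e strategy \<Rightarrow> nat \<Rightarrow> 'e memory \<Rightarrow> 'o \<Rightarrow> real" where
  "future_cost g t m \<omega> \<equiv> cost_to_go S \<gamma> \<omega> (closed_loop S g \<omega> (mem_acts m)) t"

lemma cost_to_go_props:
  assumes "\<omega> \<in> sample_space S" and "\<And>i. u i \<in> act_set S"
  shows "cost_to_go S \<gamma> \<omega> u t = incurred_cost S \<omega> u t + \<gamma> * cost_to_go S \<gamma> \<omega> u (Suc t)"
    and "0 \<le> cost_to_go S \<gamma> \<omega> u t" and "cost_to_go S \<gamma> \<omega> u t \<le> cmax / (1 - \<gamma>)"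
proof -
  have c: "0 \<le> incurred_cost S \<omega> u i \<and> incurred_cost S \<omega> u i \<le> cmax" for i
    using stage_in_range(2)[OF assms(1), of i u] assms(2) cost_set_bounds by auto
  have geo: "(\<lambda>k. \<gamma> ^ k * cmax) sums (cmax / (1 - \<gamma>))"
    using sums_mult2[OF geometric_sums[of \<gamma>], of cmax] discount by simp
  have le: "\<gamma> ^ k * incurred_cost S \<omega> u (i + k) \<le> \<gamma> ^ k * cmax" for i k
    using c discount by (intro mult_left_mono) auto
  have nn: "0 \<le> \<gamma> ^ k * incurred_cost S \<omega> u (i + k)" for i k
    using c discount by simp
  have summ: "summable (\<lambda>k. \<gamma> ^ k * incurred_cost S \<omega> u (i + k))" for i
    by (rule summable_comparison_test'[OF sums_summable[OF geo], of 0])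
      (use le nn in \<open>simp add: abs_of_nonneg\<close>)
  show "0 \<le> cost_to_go S \<gamma> \<omega> u t"
    unfolding cost_to_go_def using nn by (intro suminf_nonneg summ) auto
  show "cost_to_go S \<gamma> \<omega> u t \<le> cmax / (1 - \<gamma>)"
    unfolding cost_to_go_def sums_unique[OF geo]
    by (rule suminf_le[OF le summ sums_summable[OF geo]])
  have "cost_to_go S \<gamma> \<omega> u t
      = incurred_cost S \<omega> u t + (\<Sum>k. \<gamma> ^ Suc k * incurred_cost S \<omega> u (t + Suc k))"
    unfolding cost_to_go_def using suminf_split_head[OF summ[of t]] by simp
  also have "(\<Sum>k. \<gamma> ^ Suc k * incurred_cost S \<omega> u (t + Suc k)) = \<gamma> * cost_to_go S \<gamma> \<omega> u (Suc t)"
    unfolding cost_to_go_def using suminf_mult[OF summ[of "Suc t"], of \<gamma>] by (simp add: mult.assoc)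
  finally show "cost_to_go S \<gamma> \<omega> u t = incurred_cost S \<omega> u t + \<gamma> * cost_to_go S \<gamma> \<omega> u (Suc t)" .
qed

definition next_memory :: "nat \<Rightarrow> 'e memory \<Rightarrow> 'e \<Rightarrow> 'o \<Rightarrow> 'e memory" where
  "next_memory t m u \<omega> = memory_at S \<omega> ((!) (mem_acts m @ [u])) (Suc t)"

definition stage_cost :: "nat \<Rightarrow> 'e memory \<Rightarrow> 'e \<Rightarrow> 'o \<Rightarrow> real" where
  "stage_cost t m u \<omega> = incurred_cost S \<omega> ((!) (mem_acts m @ [u])) t"

lemma mem_range_eq:
  "mem_range S \<sigma> t m u = (\<lambda>\<omega>. (stage_cost t m u \<omega>, \<sigma> (Suc t) (next_memory t m u \<omega>))) ` consistent S t m"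
  by (simp add: mem_range_def stage_cost_def next_memory_def Let_def)

lemma feasible_acts:
  assumes "feasible S t m"
  shows "length (mem_acts m) = t" "set (mem_acts m) \<subseteq> act_set S"
  using assms by (auto simp: feasible_def memory_space_def mem_acts_def)

lemma consistentD:
  "\<omega> \<in> consistent S t m \<Longrightarrow> \<omega> \<in> sample_space S"
  by (simp add: consistent_def)

lemma snoc_acts:
  assumes m: "feasible S t m" and u: "u \<in> act_set S" and i: "i < Suc t"
  shows "(mem_acts m @ [u]) ! i \<in> act_set S"
  using feasible_acts[OF m] u i nth_mem[of i "mem_acts m @ [u]"] by auto

lemma mem_acts_next_memory:
  assumes "feasible S t m"
  shows "mem_acts (next_memory t m u \<omega>) = mem_acts m @ [u]"
  using feasible_acts(1)[OF assms] map_nth[of "mem_acts m @ [u]"]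
  by (simp add: next_memory_def del: upt_Suc)

text \<open>The place where observability of costs is used. The successor memory records the stage cost and
  extends \<open>m\<close>, so the sample points consistent with it are consistent with \<open>m\<close> and
  incur the same stage cost. The adversary can thus postpone the choice of the sample point: whatever
  is chosen later keeps the cost already counted.\<close>

lemma consistent_next_memory:
  assumes m: "feasible S t m" and w: "\<omega> \<in> consistent S t m"
    and w': "\<omega>' \<in> consistent S (Suc t) (next_memory t m u \<omega>)"
  shows "\<omega>' \<in> consistent S t m" and "stage_cost t m u \<omega>' = stage_cost t m u \<omega>"
proof -
  let ?u = "(!) (mem_acts m @ [u])"
  have eq: "memory_at S \<omega>' ?u (Suc t) = memory_at S \<omega> ?u (Suc t)"
    using w' mem_acts_next_memory[OF m] by (simp add: consistent_def next_memory_def)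
  show "stage_cost t m u \<omega>' = stage_cost t m u \<omega>"
    using memory_at_Suc_eqD(2)[OF eq] by (simp add: stage_cost_def)
  have cong: "memory_at S \<omega> ?u t = memory_at S \<omega> ((!) (mem_acts m)) t" for \<omega>
    using feasible_acts(1)[OF m] by (intro memory_at_cong) (simp add: nth_append)
  show "\<omega>' \<in> consistent S t m"
    using memory_at_Suc_eqD(1)[OF eq] w w' by (simp add: consistent_def cong)
qed

lemma next_memory_consistent:
  assumes m: "feasible S t m" and w: "\<omega> \<in> consistent S t m"
  shows "\<omega> \<in> consistent S (Suc t) (next_memory t m u \<omega>)"
  using mem_acts_next_memory[OF m] consistentD[OF w]
  by (simp add: consistent_def) (simp add: next_memory_def)

lemma next_memory_feasible:
  assumes m: "feasible S t m" and u: "u \<in> act_set S" and w: "\<omega> \<in> consistent S t m"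
  shows "feasible S (Suc t) (next_memory t m u \<omega>)"
proof -
  have "next_memory t m u \<omega> \<in> memory_space S (Suc t)"
    unfolding next_memory_def
    by (rule memory_at_in_space[OF consistentD[OF w] snoc_acts[OF m u]])
  then show ?thesis using next_memory_consistent[OF m w] by (auto simp: feasible_def)
qed

lemma strategy_action:
  assumes "g \<in> strategies S" and "feasible S t m"
  shows "g t m \<in> act_set S"
  using assms by (auto simp: strategies_def feasible_def)

lemma closed_loop_action:
  assumes m: "feasible S t m" and w: "\<omega> \<in> consistent S t m"
  shows "closed_loop S g \<omega> (mem_acts m) t = g t m"
proof -
  have "memory_at S \<omega> (closed_loop S g \<omega> (mem_acts m)) t = memory_at S \<omega> ((!) (mem_acts m)) t"
    using feasible_acts(1)[OF m] by (intro memory_at_cong closed_loop_past) simp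
  also have "\<dots> = m" using w by (simp add: consistent_def)
  finally show ?thesis using feasible_acts(1)[OF m] by (simp add: closed_loop_future)
qed

lemma future_cost_bounds:
  assumes "g \<in> strategies S" and "feasible S t m" and "\<omega> \<in> consistent S t m"
  shows "0 \<le> future_cost g t m \<omega>" and "future_cost g t m \<omega> \<le> cmax / (1 - \<gamma>)"
  using cost_to_go_props(2,3) closed_loop_in_act_set[OF assms(1)] consistentD[OF assms(3)]
    feasible_acts(2)[OF assms(2)] by blast+

text \<open>The memory \<open>m'\<close> enters only through its action list, so the step applies to successor
  memories produced by a sample point other than \<open>\<omega>\<close>.\<close>

lemma future_cost_step:
  assumes g: "g \<in> strategies S" and m: "feasible S t m" and w: "\<omega> \<in> consistent S t m"
    and m': "mem_acts m' = mem_acts m @ [g t m]"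
  shows "future_cost g t m \<omega> = stage_cost t m (g t m) \<omega> + \<gamma> * future_cost g (Suc t) m' \<omega>"
proof -
  let ?v = "closed_loop S g \<omega> (mem_acts m)"
  have a: "?v t = g t m" by (rule closed_loop_action[OF m w])
  have "closed_loop S g \<omega> (mem_acts m') = ?v"
    using closed_loop_snoc[of S g \<omega> "mem_acts m"] feasible_acts(1)[OF m] a m' by simp
  moreover have "incurred_cost S \<omega> ?v t = stage_cost t m (g t m) \<omega>"
  proof -
    have "map ?v [0..<Suc t] = map ((!) (mem_acts m @ [g t m])) [0..<Suc t]"
      using feasible_acts(1)[OF m] a by (auto simp: closed_loop_past nth_append)
    then show ?thesis unfolding stage_cost_def incurred_cost_def by (simp only:)
  qed
  moreover have "?v i \<in> act_set S" for i
    by (rule closed_loop_in_act_set[OF g consistentD[OF w] feasible_acts(2)[OF m]])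
  ultimately show ?thesis using cost_to_go_props(1)[OF consistentD[OF w], of ?v t] by simp
qed

lemma strategy_value_initial:
  "strategy_value S \<gamma> g 0 m = (SUP \<omega>\<in>consistent S 0 m. future_cost g 0 m \<omega>)"
  by (simp add: strategy_value_def cost_range_def Let_def image_image accrued_cost_def)

lemma future_cost_le_strategy_value:
  assumes "g \<in> strategies S" "feasible S 0 m" "\<omega> \<in> consistent S 0 m"
  shows "future_cost g 0 m \<omega> \<le> strategy_value S \<gamma> g 0 m"
  unfolding strategy_value_initial
  using future_cost_bounds(2)[OF assms(1,2)] by (intro cSUP_upper[OF assms(3)] bdd_aboveI2) auto

lemma optimal_value_le:
  assumes "g \<in> strategies S" "feasible S 0 m"
  shows "optimal_value S \<gamma> 0 m \<le> strategy_value S \<gamma> g 0 m"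
proof -
  have "0 \<le> strategy_value S \<gamma> g 0 m" if g: "g \<in> strategies S" for g
  proof -
    obtain \<omega> where "\<omega> \<in> consistent S 0 m" using assms(2) by (auto simp: feasible_def)
    then show ?thesis
      using future_cost_bounds(1)[OF g assms(2)] future_cost_le_strategy_value[OF g assms(2)]
      by (meson order_trans)
  qed
  then show ?thesis unfolding optimal_value_def
    by (intro cINF_lower[OF _ assms(1)] bdd_belowI2[where m=0])
qed

end

section \<open>Comparison of the dynamic program with the control problem\<close>

locale approx_controlled = controlled S \<gamma> cmax
  for S :: "('o, 'e::metric_space) control_system" and \<gamma> cmax :: real +
  fixes \<epsilon> L :: real and Shat :: "'s::metric_space set"
    and \<sigma> :: "nat \<Rightarrow> 'e memory \<Rightarrow> 's" and R :: "'s \<Rightarrow> 'e \<Rightarrow> (real \<times> 's) set"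
  assumes info: "approx_info_state S \<epsilon> Shat \<sigma> R"
    and error_nonneg: "0 \<le> \<epsilon>"
    and cost_bound: "0 \<le> cmax"
    and iterates_lipschitz: "\<And>n. L-lipschitz_on Shat (dp_iterate (act_set S) \<gamma> R n)"
begin

sublocale bounded_dp "act_set S" \<gamma> R Shat cmax
proof
  show "act_set S \<noteq> {}" using problem by (simp add: control_problem_def)
  fix s u assume "s \<in> Shat" "u \<in> act_set S"
  with info have "R s u \<noteq> {} \<and> R s u \<subseteq> cost_set S \<times> Shat"
    unfolding approx_info_state_def by simp
  then show "R s u \<noteq> {}" "R s u \<subseteq> {0..cmax} \<times> Shat"
    using cost_set_bounds by auto
qed (use discount cost_bound in auto)

abbreviation \<Lambda> :: "'s \<Rightarrow> real" where
  "\<Lambda> \<equiv> dp_limit (act_set S) \<gamma> R"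

abbreviation Lhat :: real where
  "Lhat \<equiv> max (\<gamma> * L) 1"

lemma info_in_Shat: "feasible S t m \<Longrightarrow> \<sigma> t m \<in> Shat"
  using info unfolding approx_info_state_def feasible_def by blast

lemma info_range_eq:
  "feasible S t m \<Longrightarrow> u \<in> act_set S \<Longrightarrow> info_range S \<sigma> t (\<sigma> t m) u = R (\<sigma> t m) u"
  using info unfolding approx_info_state_def by (simp del: split_paired_All)

lemma mem_range_close:
  assumes "feasible S t m" "u \<in> act_set S"
  shows "hausdorff_distance sum_dist (mem_range S \<sigma> t m u) (R (\<sigma> t m) u) \<le> \<epsilon>"
proof -
  have "hausdorff_distance sum_dist (mem_range S \<sigma> t m u) (info_range S \<sigma> t (\<sigma> t m) u) \<le> \<epsilon>"
    using info[unfolded approx_info_state_def, THEN conjunct2, THEN conjunct2, THEN conjunct1] assms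
    by (simp del: split_paired_All)
  then show ?thesis by (simp only: info_range_eq[OF assms])
qed

lemma mem_range_subset:
  assumes "feasible S t m" "u \<in> act_set S"
  shows "mem_range S \<sigma> t m u \<subseteq> R (\<sigma> t m) u"
  unfolding info_range_eq[OF assms, symmetric] using assms(1) by (auto simp: info_range_def)

text \<open>The cost coordinate has Lipschitz constant \<open>1\<close> and the state coordinate
  \<open>\<gamma> * L\<close>; for the sum of the two metrics the larger one serves both.\<close>

lemma stage_value_lipschitz:
  assumes "snd p \<in> Shat" "snd q \<in> Shat"
  shows "fst q + \<gamma> * \<Lambda> (snd q) \<le> fst p + \<gamma> * \<Lambda> (snd p) + Lhat * sum_dist p q"
proof -
  have "L-lipschitz_on Shat \<Lambda>"
    by (rule lipschitz_on_pointwise_limit[OF iterates_lipschitz dp_iterate_tendsto])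
  from lipschitz_onD[OF this assms]
  have "\<Lambda> (snd q) - \<Lambda> (snd p) \<le> L * dist (snd p) (snd q)" by (auto simp: dist_real_def)
  then have "\<gamma> * (\<Lambda> (snd q) - \<Lambda> (snd p)) \<le> \<gamma> * (L * dist (snd p) (snd q))"
    using discount by (intro mult_left_mono) auto
  also have "\<dots> \<le> Lhat * dist (snd p) (snd q)"
    unfolding mult.assoc[symmetric] by (intro mult_right_mono) auto
  finally have s: "\<gamma> * \<Lambda> (snd q) - \<gamma> * \<Lambda> (snd p) \<le> Lhat * dist (snd p) (snd q)"
    by (simp add: right_diff_distrib)
  have "fst q - fst p \<le> 1 * dist (fst p) (fst q)" by (simp add: dist_real_def)
  also have "\<dots> \<le> Lhat * dist (fst p) (fst q)" by (intro mult_right_mono) auto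
  finally show ?thesis using s by (simp add: sum_dist_def distrib_left)
qed

text \<open>One step of the adversary, for an arbitrary action: the worst pair in the range given the
  information state is approximated by a pair that is possible given the memory.\<close>

lemma bad_sample_point:
  assumes m: "feasible S t m" and u: "u \<in> act_set S" and \<kappa>: "Lhat * \<epsilon> < \<kappa>"
  shows "\<exists>\<omega>\<in>consistent S t m.
    \<Lambda> (\<sigma> t m) - \<kappa> \<le> stage_cost t m u \<omega> + \<gamma> * \<Lambda> (\<sigma> (Suc t) (next_memory t m u \<omega>))"
proof -
  let ?s = "\<sigma> t m" and ?P = "mem_range S \<sigma> t m u"
  let ?f = "\<lambda>p. fst p + \<gamma> * \<Lambda> (snd p)"
  have s: "?s \<in> Shat" by (rule info_in_Shat[OF m])
  have sub: "R ?s u \<subseteq> {0..cmax} \<times> Shat" by (rule successors_subset[OF s u])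
  have P: "?P \<noteq> {}" "?P \<subseteq> R ?s u"
    using m mem_range_subset[OF m u] by (auto simp: mem_range_eq feasible_def)
  note close = mem_range_close[OF m u]
  obtain D where D: "\<And>x y. x \<in> Shat \<Longrightarrow> y \<in> Shat \<Longrightarrow> dist x y \<le> D"
    using info bounded_two_points[of Shat] by (auto simp: approx_info_state_def)
  have bound: "sum_dist p q \<le> cmax + D" if "p \<in> ?P" "q \<in> R ?s u" for p q
  proof -
    have "p \<in> {0..cmax} \<times> Shat" "q \<in> {0..cmax} \<times> Shat" using that P(2) sub by auto
    then show ?thesis using D[of "snd p" "snd q"]
      by (auto simp: sum_dist_def dist_real_def mem_Times_iff intro!: add_mono)
  qed
  have Lhat: "0 < Lhat" by simp
  \<comment> \<open>The slack \<open>\<kappa> - Lhat * \<epsilon>\<close> pays, half each, for a near-maximiser \<open>q\<close> and a near-closest \<open>p\<close>.\<close>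
  define \<rho> where "\<rho> = (\<kappa> - Lhat * \<epsilon>) / 2"
  have \<rho>: "0 < \<rho>" "\<kappa> = Lhat * \<epsilon> + \<rho> + \<rho>" using \<kappa> by (simp_all add: \<rho>_def field_simps)
  have "\<Lambda> ?s \<le> worst_case \<gamma> R \<Lambda> ?s u"
    using dp_operator_lower[where f=\<Lambda>, OF s u dp_limit_bounds] dp_limit_fixed_point[OF s] by simp
  then have "\<exists>q\<in>R ?s u. \<Lambda> ?s - \<rho> \<le> ?f q"
    using worst_case_least[OF s u, of \<Lambda> "\<Lambda> ?s - \<rho>"] \<rho>(1) by fastforce
  then obtain q where q: "q \<in> R ?s u" "\<Lambda> ?s - \<rho> \<le> ?f q" by blast
  have "\<epsilon> < \<epsilon> + \<rho> / Lhat" using \<rho>(1) Lhat by simp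
  moreover have "0 \<le> sum_dist p q" for p q :: "real \<times> 's" by (simp add: sum_dist_def)
  ultimately obtain p where p: "p \<in> ?P" "sum_dist p q < \<epsilon> + \<rho> / Lhat"
    using hausdorff_distance_approx[where \<eta>=sum_dist, OF P(1) q(1) _ bound close] by blast
  have "Lhat * sum_dist p q \<le> Lhat * (\<epsilon> + \<rho> / Lhat)"
    using p(2) Lhat by (intro mult_left_mono) auto
  also have "\<dots> = Lhat * \<epsilon> + \<rho>" using Lhat by (simp add: distrib_left)
  finally have "Lhat * sum_dist p q \<le> Lhat * \<epsilon> + \<rho>" .
  moreover have "?f q \<le> ?f p + Lhat * sum_dist p q"
    using p(1) q(1) P(2) sub by (intro stage_value_lipschitz) auto
  ultimately have "\<Lambda> ?s - \<kappa> \<le> ?f p" using q(2) \<rho>(2) by linarith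
  then show ?thesis using p(1) by (auto simp: mem_range_eq)
qed

text \<open>The adversary's sample point is built backwards. The one found at time \<open>t\<close> is used only
  for the successor memory it leads to; the induction hypothesis then supplies another one consistent
  with that memory, and it has the same stage cost.\<close>

lemma future_cost_lower_bound:
  assumes g: "g \<in> strategies S" and \<kappa>: "Lhat * \<epsilon> < \<kappa>"
  shows "feasible S t m \<Longrightarrow> \<exists>\<omega>\<in>consistent S t m.
    \<Lambda> (\<sigma> t m) - \<kappa> / (1 - \<gamma>) - \<gamma> ^ n * value_bound \<le> future_cost g t m \<omega>"
proof (induction n arbitrary: t m)
  case 0
  then obtain \<omega> where w: "\<omega> \<in> consistent S t m" by (auto simp: feasible_def)
  have "0 \<le> Lhat * \<epsilon>" using error_nonneg by simp
  then have "0 \<le> \<kappa> / (1 - \<gamma>)" using \<kappa> discount by simp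
  then show ?case
    using w future_cost_bounds(1)[OF g 0 w] dp_limit_bounds[OF info_in_Shat[OF 0]]
    by (intro bexI[of _ \<omega>]) auto
next
  case (Suc n)
  note m = Suc.prems
  have u: "g t m \<in> act_set S" by (rule strategy_action[OF g m])
  obtain \<omega> where w: "\<omega> \<in> consistent S t m"
    and low: "\<Lambda> (\<sigma> t m) - \<kappa> \<le> stage_cost t m (g t m) \<omega>
        + \<gamma> * \<Lambda> (\<sigma> (Suc t) (next_memory t m (g t m) \<omega>))"
    using bad_sample_point[OF m u \<kappa>] by blast
  let ?m' = "next_memory t m (g t m) \<omega>"
  obtain \<omega>' where w': "\<omega>' \<in> consistent S (Suc t) ?m'"
    and IH: "\<Lambda> (\<sigma> (Suc t) ?m') - \<kappa> / (1 - \<gamma>) - \<gamma> ^ n * value_bound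
        \<le> future_cost g (Suc t) ?m' \<omega>'"
    using Suc.IH[OF next_memory_feasible[OF m u w]] by blast
  note same = consistent_next_memory[OF m w w']
  have "\<gamma> * (\<Lambda> (\<sigma> (Suc t) ?m') - \<kappa> / (1 - \<gamma>) - \<gamma> ^ n * value_bound)
      \<le> \<gamma> * future_cost g (Suc t) ?m' \<omega>'"
    using IH discount by (intro mult_left_mono) auto
  moreover have "\<kappa> + \<gamma> * (\<kappa> / (1 - \<gamma>)) = \<kappa> / (1 - \<gamma>)"
    using discount by (simp add: field_simps)
  moreover have "\<gamma> ^ Suc n * value_bound = \<gamma> * (\<gamma> ^ n * value_bound)" by simp
  ultimately have "\<Lambda> (\<sigma> t m) - \<kappa> / (1 - \<gamma>) - \<gamma> ^ Suc n * value_bound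
      \<le> stage_cost t m (g t m) \<omega>' + \<gamma> * future_cost g (Suc t) ?m' \<omega>'"
    using low same(2) unfolding right_diff_distrib by linarith
  also have "\<dots> = future_cost g t m \<omega>'"
    by (rule future_cost_step[OF g m same(1) mem_acts_next_memory[OF m], symmetric])
  finally show ?case using same(1) by blast
qed

lemma strategy_value_lower_bound:
  assumes g: "g \<in> strategies S" and m: "feasible S 0 m"
  shows "\<Lambda> (\<sigma> 0 m) - Lhat * \<epsilon> / (1 - \<gamma>) \<le> strategy_value S \<gamma> g 0 m"
proof -
  have \<kappa>: "\<Lambda> (\<sigma> 0 m) - \<kappa> / (1 - \<gamma>) \<le> strategy_value S \<gamma> g 0 m" if large: "Lhat * \<epsilon> < \<kappa>" for \<kappa>
  proof -
    have "\<Lambda> (\<sigma> 0 m) - \<kappa> / (1 - \<gamma>) - \<gamma> ^ n * value_bound \<le> strategy_value S \<gamma> g 0 m" for n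
    proof -
      obtain \<omega> where "\<omega> \<in> consistent S 0 m"
        "\<Lambda> (\<sigma> 0 m) - \<kappa> / (1 - \<gamma>) - \<gamma> ^ n * value_bound \<le> future_cost g 0 m \<omega>"
        using future_cost_lower_bound[OF g large m] by blast
      then show ?thesis using future_cost_le_strategy_value[OF g m, of \<omega>] by linarith
    qed
    moreover have "(\<lambda>n. \<Lambda> (\<sigma> 0 m) - \<kappa> / (1 - \<gamma>) - \<gamma> ^ n * value_bound)
        \<longlonglongrightarrow> \<Lambda> (\<sigma> 0 m) - \<kappa> / (1 - \<gamma>) - 0 * value_bound"
      using discount by (intro tendsto_intros LIMSEQ_power_zero) auto
    ultimately show ?thesis by (auto intro: LIMSEQ_le_const2)
  qed
  \<comment> \<open>Multiplied out by \<open>1 - \<gamma>\<close>, the bound for all \<open>\<kappa>\<close> above \<open>Lhat * \<epsilon>\<close> passes to \<open>Lhat * \<epsilon>\<close>.\<close>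
  have "(1 - \<gamma>) * (\<Lambda> (\<sigma> 0 m) - strategy_value S \<gamma> g 0 m) \<le> Lhat * \<epsilon>"
    by (rule dense_ge) (use \<kappa> discount in \<open>fastforce simp: field_simps\<close>)
  then show ?thesis using discount by (simp add: field_simps)
qed

lemma info_strategy:
  assumes "\<And>s. s \<in> Shat \<Longrightarrow> \<pi> s \<in> act_set S"
  shows "(\<lambda>t m. \<pi> (\<sigma> t m)) \<in> strategies S"
proof -
  have "\<sigma> t m \<in> Shat" if "m \<in> memory_space S t" for t m
    using info that unfolding approx_info_state_def by blast
  then show ?thesis using assms unfolding strategies_def by blast
qed

text \<open>No choice of sample point is involved here: the pair met at each step lies in the range over which
  the dynamic program takes its supremum, so the estimate follows a single trajectory.\<close>

lemma future_cost_upper_bound: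
  assumes act: "\<And>s. s \<in> Shat \<Longrightarrow> \<pi> s \<in> act_set S"
    and greedy: "\<And>s. s \<in> Shat \<Longrightarrow> worst_case \<gamma> R \<Lambda> s (\<pi> s) \<le> \<Lambda> s + \<delta>"
    and "0 \<le> \<delta>"
  shows "feasible S t m \<Longrightarrow> \<omega> \<in> consistent S t m \<Longrightarrow>
    future_cost (\<lambda>t m. \<pi> (\<sigma> t m)) t m \<omega> \<le> \<Lambda> (\<sigma> t m) + \<delta> / (1 - \<gamma>) + \<gamma> ^ n * value_bound"
proof (induction n arbitrary: t m)
  case 0
  have "0 \<le> \<delta> / (1 - \<gamma>)" using \<open>0 \<le> \<delta>\<close> discount by simp
  then show ?case
    using future_cost_bounds(2)[OF info_strategy[of \<pi>, OF act] 0]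
      dp_limit_bounds[OF info_in_Shat[OF 0(1)]] by simp
next
  case (Suc n)
  note m = Suc.prems(1) and w = Suc.prems(2)
  let ?g = "\<lambda>t m. \<pi> (\<sigma> t m)" and ?s = "\<sigma> t m"
  let ?m' = "next_memory t m (\<pi> ?s) \<omega>"
  have s: "?s \<in> Shat" by (rule info_in_Shat[OF m])
  have u: "\<pi> ?s \<in> act_set S" by (rule act[OF s])
  have "(stage_cost t m (\<pi> ?s) \<omega>, \<sigma> (Suc t) ?m') \<in> R ?s (\<pi> ?s)"
    using mem_range_subset[OF m u] w by (auto simp: mem_range_eq)
  then have "stage_cost t m (\<pi> ?s) \<omega> + \<gamma> * \<Lambda> (\<sigma> (Suc t) ?m') \<le> worst_case \<gamma> R \<Lambda> ?s (\<pi> ?s)"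
    using dp_limit_bounds by (intro worst_case_upper[where f=\<Lambda> and b=value_bound, OF s u]) auto
  then have "stage_cost t m (\<pi> ?s) \<omega> + \<gamma> * \<Lambda> (\<sigma> (Suc t) ?m') \<le> \<Lambda> ?s + \<delta>"
    using greedy[OF s] by linarith
  moreover have "\<gamma> * future_cost ?g (Suc t) ?m' \<omega>
      \<le> \<gamma> * (\<Lambda> (\<sigma> (Suc t) ?m') + \<delta> / (1 - \<gamma>) + \<gamma> ^ n * value_bound)"
    using Suc.IH[OF next_memory_feasible[OF m u w] next_memory_consistent[OF m w]] discount
    by (intro mult_left_mono) auto
  moreover have "\<delta> + \<gamma> * (\<delta> / (1 - \<gamma>)) = \<delta> / (1 - \<gamma>)"
    using discount by (simp add: field_simps)
  moreover have "\<gamma> ^ Suc n * value_bound = \<gamma> * (\<gamma> ^ n * value_bound)" by simp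
  moreover have "future_cost ?g t m \<omega>
      = stage_cost t m (\<pi> ?s) \<omega> + \<gamma> * future_cost ?g (Suc t) ?m' \<omega>"
    by (rule future_cost_step[OF info_strategy[of \<pi>, OF act] m w mem_acts_next_memory[OF m]])
  ultimately show ?case unfolding distrib_left by linarith
qed

lemma strategy_value_upper_bound:
  assumes act: "\<And>s. s \<in> Shat \<Longrightarrow> \<pi> s \<in> act_set S"
    and greedy: "\<And>s. s \<in> Shat \<Longrightarrow> worst_case \<gamma> R \<Lambda> s (\<pi> s) \<le> \<Lambda> s + \<delta>"
    and "0 \<le> \<delta>" and m: "feasible S 0 m"
  shows "strategy_value S \<gamma> (\<lambda>t m. \<pi> (\<sigma> t m)) 0 m \<le> \<Lambda> (\<sigma> 0 m) + \<delta> / (1 - \<gamma>)"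
  unfolding strategy_value_initial
proof (rule cSUP_least)
  fix \<omega> assume w: "\<omega> \<in> consistent S 0 m"
  have "(\<lambda>n. \<Lambda> (\<sigma> 0 m) + \<delta> / (1 - \<gamma>) + \<gamma> ^ n * value_bound)
      \<longlonglongrightarrow> \<Lambda> (\<sigma> 0 m) + \<delta> / (1 - \<gamma>) + 0 * value_bound"
    using discount by (intro tendsto_intros LIMSEQ_power_zero) auto
  then have "future_cost (\<lambda>t m. \<pi> (\<sigma> t m)) 0 m \<omega>
      \<le> \<Lambda> (\<sigma> 0 m) + \<delta> / (1 - \<gamma>) + 0 * value_bound"
    using future_cost_upper_bound[OF act greedy \<open>0 \<le> \<delta>\<close> m w]
    by (intro LIMSEQ_le_const) auto
  then show "future_cost (\<lambda>t m. \<pi> (\<sigma> t m)) 0 m \<omega> \<le> \<Lambda> (\<sigma> 0 m) + \<delta> / (1 - \<gamma>)" by simp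
qed (use m in \<open>simp add: feasible_def\<close>)

lemma optimal_value_upper_bound:
  assumes m: "feasible S 0 m"
  shows "optimal_value S \<gamma> 0 m \<le> \<Lambda> (\<sigma> 0 m)"
proof (rule field_le_epsilon)
  fix e :: real assume e: "0 < e"
  define \<delta> where "\<delta> = e * (1 - \<gamma>)"
  have \<delta>: "0 < \<delta>" "\<delta> / (1 - \<gamma>) = e" using e discount by (simp_all add: \<delta>_def)
  have "\<exists>u\<in>act_set S. worst_case \<gamma> R \<Lambda> s u \<le> \<Lambda> s + \<delta>" if "s \<in> Shat" for s
    using dp_operator_greatest[of "\<Lambda> s + \<delta>" \<Lambda> s] dp_limit_fixed_point[OF that] \<delta>(1) by fastforce
  then obtain \<pi> where \<pi>: "\<And>s. s \<in> Shat \<Longrightarrow> \<pi> s \<in> act_set S \<and> worst_case \<gamma> R \<Lambda> s (\<pi> s) \<le> \<Lambda> s + \<delta>"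
    by metis
  have "optimal_value S \<gamma> 0 m \<le> strategy_value S \<gamma> (\<lambda>t m. \<pi> (\<sigma> t m)) 0 m"
    using \<pi> by (intro optimal_value_le[OF _ m] info_strategy) auto
  also have "\<dots> \<le> \<Lambda> (\<sigma> 0 m) + \<delta> / (1 - \<gamma>)"
    using \<pi> \<delta>(1) by (intro strategy_value_upper_bound[OF _ _ _ m]) auto
  finally show "optimal_value S \<gamma> 0 m \<le> \<Lambda> (\<sigma> 0 m) + e" by (simp only: \<delta>(2))
qed

lemma optimal_value_lower_bound:
  assumes m: "feasible S 0 m"
  shows "\<Lambda> (\<sigma> 0 m) - Lhat * \<epsilon> / (1 - \<gamma>) \<le> optimal_value S \<gamma> 0 m"
proof -
  obtain u where "u \<in> act_set S" using actions_nonempty by auto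
  then have "(\<lambda>t m. u) \<in> strategies S" by (simp add: strategies_def)
  then have "strategies S \<noteq> {}" by blast
  then show ?thesis unfolding optimal_value_def
    by (rule cINF_greatest) (rule strategy_value_lower_bound[OF _ m])
qed

end

theorem theorem3:
  fixes S :: "('o, 'e::metric_space) control_system"
    and \<gamma> \<epsilon> L :: real
    and Shat :: "'s::metric_space set"
    and \<sigma> :: "nat \<Rightarrow> 'e memory \<Rightarrow> 's"
    and R :: "'s \<Rightarrow> 'e \<Rightarrow> (real \<times> 's) set"
    and y\<^sub>0 :: 'e
  assumes "control_problem S"
    and "0 < \<gamma>" and "\<gamma> < 1"
    and "0 \<le> \<epsilon>"
    and "approx_info_state S \<epsilon> Shat \<sigma> R"
    and "0 \<le> L"
    and "\<And>n. L-lipschitz_on Shat (dp_iterate (act_set S) \<gamma> R n)"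
    and "feasible S 0 ([y\<^sub>0], [], [])"
  shows "\<bar>optimal_value S \<gamma> 0 ([y\<^sub>0], [], [])
            - dp_limit (act_set S) \<gamma> R (\<sigma> 0 ([y\<^sub>0], [], []))\<bar>
           \<le> max (\<gamma> * L) 1 * \<epsilon> / (1 - \<gamma>) \<and>
    (\<forall>\<pi>. (\<forall>n. inf_attained (act_set S) \<gamma> R Shat (dp_iterate (act_set S) \<gamma> R n)) \<and>
         inf_attained (act_set S) \<gamma> R Shat (dp_limit (act_set S) \<gamma> R) \<and>
         (\<forall>s\<in>Shat. is_arg_min (worst_case \<gamma> R (dp_limit (act_set S) \<gamma> R) s)
                     (\<lambda>u. u \<in> act_set S) (\<pi> s)) \<longrightarrow>
         \<bar>optimal_value S \<gamma> 0 ([y\<^sub>0], [], [])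
            - strategy_value S \<gamma> (\<lambda>t m. \<pi> (\<sigma> t m)) 0 ([y\<^sub>0], [], [])\<bar>
           \<le> 2 * max (\<gamma> * L) 1 * \<epsilon> / (1 - \<gamma>))"
proof -
  let ?m = "([y\<^sub>0], [], []) :: 'e memory"
  let ?\<Lambda> = "dp_limit (act_set S) \<gamma> R"
  obtain cmin cmax where c: "cmin \<in> cost_set S" "\<And>c. c \<in> cost_set S \<Longrightarrow> c \<le> cmax"
    and c0: "cost_set S \<subseteq> {0..}"
    using assms(1) unfolding control_problem_def by blast
  have sub: "cost_set S \<subseteq> {0..cmax}" and "0 \<le> cmax"
    using c c0 by (auto intro: order_trans)
  interpret approx_controlled S \<gamma> cmax \<epsilon> L Shat \<sigma> R
    by unfold_locales (use assms sub \<open>0 \<le> cmax\<close> in auto)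
  note m = assms(8)
  note lower = optimal_value_lower_bound[OF m] and upper = optimal_value_upper_bound[OF m]
  have nonneg: "0 \<le> Lhat * \<epsilon> / (1 - \<gamma>)" using error_nonneg discount by simp
  have a: "\<bar>optimal_value S \<gamma> 0 ?m - ?\<Lambda> (\<sigma> 0 ?m)\<bar> \<le> Lhat * \<epsilon> / (1 - \<gamma>)"
    using lower upper nonneg by linarith
  have b: "\<bar>optimal_value S \<gamma> 0 ?m - strategy_value S \<gamma> (\<lambda>t m. \<pi> (\<sigma> t m)) 0 ?m\<bar>
      \<le> 2 * Lhat * \<epsilon> / (1 - \<gamma>)"
    if \<pi>: "\<forall>s\<in>Shat. is_arg_min (worst_case \<gamma> R ?\<Lambda> s) (\<lambda>u. u \<in> act_set S) (\<pi> s)" for \<pi>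
  proof -
    have act: "\<pi> s \<in> act_set S" if "s \<in> Shat" for s
      using \<pi> that by (auto simp: is_arg_min_def)
    have greedy: "worst_case \<gamma> R ?\<Lambda> s (\<pi> s) \<le> ?\<Lambda> s + 0" if "s \<in> Shat" for s
    proof -
      have "worst_case \<gamma> R ?\<Lambda> s (\<pi> s) \<le> dp_operator (act_set S) \<gamma> R ?\<Lambda> s"
        using \<pi> that by (intro dp_operator_greatest) (auto simp: is_arg_min_def not_less)
      then show ?thesis by (simp add: dp_limit_fixed_point[OF that])
    qed
    have "strategy_value S \<gamma> (\<lambda>t m. \<pi> (\<sigma> t m)) 0 ?m \<le> ?\<Lambda> (\<sigma> 0 ?m)"
      using strategy_value_upper_bound[OF act greedy order_refl m] by simp
    moreover have "optimal_value S \<gamma> 0 ?m \<le> strategy_value S \<gamma> (\<lambda>t m. \<pi> (\<sigma> t m)) 0 ?m"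
      by (rule optimal_value_le[OF info_strategy[OF act] m])
    moreover have "2 * Lhat * \<epsilon> / (1 - \<gamma>) = 2 * (Lhat * \<epsilon> / (1 - \<gamma>))" by simp
    ultimately show ?thesis using lower nonneg by linarith
  qed
  show ?thesis using a b by blast
qed

end
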